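(* Let $(\mathbf m^\star,\mathbf n^\star,\boldsymbol\mu^\star,\boldsymbol\rho^\star,\boldsymbol\lambda^\star)$ be an equilibrium matching pattern under a perfectly competitive market (as defined in the context). Then $(\mathbf m^\star,\mathbf n^\star)$ maximizes the social surplus; that is, $(\mathbf m^\star,\mathbf n^\star)$ is an optimal solution of the socially optimal matching problem [SO]: it is feasible for [SO] and minimizes the social cost $$z(\mathbf m,\mathbf n)=\sum_{j\in\mathcal J}\sum_{b\in\mathcal B_j}\sum_{t\in\tilde{\mathcal T}} n^b_t c^b_t+\sum_{t\in\mathcal T}\sum_{w\in\mathcal W}\sum_{a\in\mathcal A_{(t,w)}}\sum_{r\in\tilde{\mathcal R}} m^a_r c^a_r$$ over all feasible $(\mathbf m,\mathbf n)$ of [SO].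
   Context: Setting. $\mathcal J$ (task categories, i.e. pickup-delivery location pairs), $\mathcal W$ (driver origin-destination pairs) and $\mathcal T=\{1,\dots,T\}$ (time windows) are finite sets; $\tilde{\mathcal T}=\mathcal T\cup\{0\}$, where $0$ is the shippers' opt-out option. For each $j\in\mathcal J$, $\mathcal B_j$ is a finite set of shippers; for each $(t,w)\in\mathcal T\times\mathcal W$, $\mathcal A_{(t,w)}$ is a finite set of drivers (all these sets are pairwise disjoint). $\mathcal R$ is the finite set of task bundles, i.e. lists $r=[j_1,\dots,j_k]$ with $j_1,\dots,j_k\in\mathcal J$ and $1\le k\le K$; $\tilde{\mathcal R}=\mathcal R\cup\{\emptyset\}$, where $\emptyset$ means performing no task. $\delta_{r,j}\in\mathbb Z_{\ge 0}$ is the number of tasks of category $j$ in $r$ (so $\delta_{\emptyset,j}=0$). $c^b_t\in\mathbb R$ is the perceived cost of shipper $b$ for option $t\in\tilde{\mathcal T}$, and $c^a_r\in\mathbb R$ is the perceived cost of driver $a$ for option $r\in\tilde{\mathcal R}$. Problem [SO]: minimize $z(\mathbf m,\mathbf n)$ subject to - $\sum_{b\in\mathcal B_j}n^b_t\le\sum_{w\in\mathcal W}\sum_{a\in\mathcal A_{(t,w)}}\sum_{r\in\mathcal R}m^a_r\delta_{r,j}$ for all $j\in\mathcal J$, $t\in\mathcal T$; - $\sum_{t\in\tilde{\mathcal T}}n^b_t=1$ and $n^b_t\in\{0,1\}$ for all $t\in\tilde{\mathcal T}$, $b\in\mathcal B_j$, $j\in\mathcal J$; - $\sum_{r\in\tilde{\mathcal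 R}}m^a_r=1$ and $m^a_r\in\{0,1\}$ for all $r\in\tilde{\mathcal R}$, $a\in\mathcal A_{(t,w)}$, $(t,w)\in\mathcal T\times\mathcal W$. Social surplus means the negative of the social cost $z$. Equilibrium matching pattern: a tuple $(\mathbf m^\star,\mathbf n^\star,\boldsymbol\mu^\star,\boldsymbol\rho^\star,\boldsymbol\lambda^\star)$ with $\mathbf n^\star=(n^{b\star}_t)$ and $\mathbf m^\star=(m^{a\star}_r)$ binary choice variables such that each shipper chooses exactly one $t\in\tilde{\mathcal T}$ and each driver exactly one $r\in\tilde{\mathcal R}$ (the last two groups of constraints of [SO]), with $\mu^\star_{b(j)},\rho^\star_{a(t,w)}\in\mathbb R$ and $\lambda^\star_{(t,j)}\ge 0$ for $t\in\mathcal T$, $j\in\mathcal J$ (and the convention $\lambda^\star_{(0,j)}=0$), satisfying: (i) (shippers) for every $j\in\mathcal J$, $b\in\mathcal B_j$, $t\in\tilde{\mathcal T}$: $c^b_t+\lambda^\star_{(t,j)}=\mu^\star_{b(j)}$ if $n^{b\star}_t>0$, and $c^b_t+\lambda^\star_{(t,j)}\ge\mu^\star_{b(j)}$ if $n^{b\star}_t=0$; (ii) (drivers) for every $(t,w)$, $a\in\mathcal A_{(t,w)}$, $r\in\tilde{\mathcal R}$: $c^a_r-\sum_{j\in\mathcal J}\delta_{r,j}\lambda^\star_{(t,j)}=\rho^\star_{a(t,w)}$ if $m^{a\star}_r>0$, and $c^a_r-\sum_{j\in\mathcal J}\delta_{r,j}\lambda^\star_{(t,j)}\ge\rho^\star_{a(t,w)}$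 if $m^{a\star}_r=0$; (iii) (market clearing) for every $j\in\mathcal J$, $t\in\mathcal T$: $\sum_{b\in\mathcal B_j}n^{b\star}_t=\sum_{w}\sum_{a\in\mathcal A_{(t,w)}}\sum_{r\in\mathcal R}m^{a\star}_r\delta_{r,j}$ if $\lambda^\star_{(t,j)}>0$, and $\sum_{b\in\mathcal B_j}n^{b\star}_t\le\sum_{w}\sum_{a\in\mathcal A_{(t,w)}}\sum_{r\in\mathcal R}m^{a\star}_r\delta_{r,j}$ if $\lambda^\star_{(t,j)}=0$. *)

theory Defs
  imports Complex_Main "HOL-Library.Disjoint_Sets"
begin

text \<open>
  The time windows are \<open>1, \<dots>, horizon\<close>; option \<open>0\<close> is the shippers' opt-out.
  A task bundle is a nonempty list of task categories and the option of performing
  no task is the empty list.  Shippers and drivers live in different types, so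
  shipper sets and driver sets are disjoint from each other by construction.
\<close>

record ('j, 'w, 'b, 'a) matching_market =
  tasks :: "'j set"
  od_pairs :: "'w set"
  horizon :: nat
  max_bundle :: nat
  shippers :: "'j \<Rightarrow> 'b set"
  drivers :: "nat \<Rightarrow> 'w \<Rightarrow> 'a set"
  shipper_cost :: "'b \<Rightarrow> nat \<Rightarrow> real"
  driver_cost :: "'a \<Rightarrow> 'j list \<Rightarrow> real"

definition windows :: "('j, 'w, 'b, 'a) matching_market \<Rightarrow> nat set" where
  "windows M = {1..horizon M}"

definition shipper_alternatives :: "('j, 'w, 'b, 'a) matching_market \<Rightarrow> nat set" where
  "shipper_alternatives M = windows M \<union> {0}"

definition bundles :: "('j, 'w, 'b, 'a) matching_market \<Rightarrow> 'j list set" where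
  "bundles M = {r. set r \<subseteq> tasks M \<and> 1 \<le> length r \<and> length r \<le> max_bundle M}"

definition driver_alternatives :: "('j, 'w, 'b, 'a) matching_market \<Rightarrow> 'j list set" where
  "driver_alternatives M = bundles M \<union> {[]}"

abbreviation task_count :: "'j list \<Rightarrow> 'j \<Rightarrow> real" where
  "task_count r j \<equiv> real (count_list r j)"

definition wf_market :: "('j, 'w, 'b, 'a) matching_market \<Rightarrow> bool" where
  "wf_market M \<longleftrightarrow>
     finite (tasks M) \<and> finite (od_pairs M) \<and>
     (\<forall>j\<in>tasks M. finite (shippers M j)) \<and>
     (\<forall>t\<in>windows M. \<forall>w\<in>od_pairs M. finite (drivers M t w)) \<and>
     disjoint_family_on (shippers M) (tasks M) \<and>
     disjoint_family_on (\<lambda>(t, w). drivers M t w) (windows M \<times> od_pairs M)"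

type_synonym ('j, 'a) driver_choice = "'a \<Rightarrow> 'j list \<Rightarrow> real"
type_synonym 'b shipper_choice = "'b \<Rightarrow> nat \<Rightarrow> real"

definition task_demand ::
  "('j, 'w, 'b, 'a) matching_market \<Rightarrow> 'b shipper_choice \<Rightarrow> 'j \<Rightarrow> nat \<Rightarrow> real" where
  "task_demand M n j t = (\<Sum>b\<in>shippers M j. n b t)"

definition task_supply ::
  "('j, 'w, 'b, 'a) matching_market \<Rightarrow> ('j, 'a) driver_choice \<Rightarrow> 'j \<Rightarrow> nat \<Rightarrow> real" where
  "task_supply M m j t =
     (\<Sum>w\<in>od_pairs M. \<Sum>a\<in>drivers M t w. \<Sum>r\<in>bundles M. m a r * task_count r j)"

definition shippers_choose_one ::
  "('j, 'w, 'b, 'a) matching_market \<Rightarrow> 'b shipper_choice \<Rightarrow> bool" where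
  "shippers_choose_one M n \<longleftrightarrow>
     (\<forall>j\<in>tasks M. \<forall>b\<in>shippers M j.
        (\<Sum>t\<in>shipper_alternatives M. n b t) = 1 \<and>
        (\<forall>t\<in>shipper_alternatives M. n b t \<in> {0, 1}))"

definition drivers_choose_one ::
  "('j, 'w, 'b, 'a) matching_market \<Rightarrow> ('j, 'a) driver_choice \<Rightarrow> bool" where
  "drivers_choose_one M m \<longleftrightarrow>
     (\<forall>t\<in>windows M. \<forall>w\<in>od_pairs M. \<forall>a\<in>drivers M t w.
        (\<Sum>r\<in>driver_alternatives M. m a r) = 1 \<and>
        (\<forall>r\<in>driver_alternatives M. m a r \<in> {0, 1}))"

definition SO_feasible ::
  "('j, 'w, 'b, 'a) matching_market \<Rightarrow> ('j, 'a) driver_choice \<times> 'b shipper_choice \<Rightarrow> bool" where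
  "SO_feasible M = (\<lambda>(m, n).
     (\<forall>j\<in>tasks M. \<forall>t\<in>windows M. task_demand M n j t \<le> task_supply M m j t) \<and>
     shippers_choose_one M n \<and> drivers_choose_one M m)"

definition social_cost ::
  "('j, 'w, 'b, 'a) matching_market \<Rightarrow> ('j, 'a) driver_choice \<times> 'b shipper_choice \<Rightarrow> real" where
  "social_cost M = (\<lambda>(m, n).
     (\<Sum>j\<in>tasks M. \<Sum>b\<in>shippers M j. \<Sum>t\<in>shipper_alternatives M.
        n b t * shipper_cost M b t) +
     (\<Sum>t\<in>windows M. \<Sum>w\<in>od_pairs M. \<Sum>a\<in>drivers M t w. \<Sum>r\<in>driver_alternatives M.
        m a r * driver_cost M a r))"

definition social_surplus ::
  "('j, 'w, 'b, 'a) matching_market \<Rightarrow> ('j, 'a) driver_choice \<times> 'b shipper_choice \<Rightarrow> real" where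
  "social_surplus M x = - social_cost M x"

definition SO_optimal ::
  "('j, 'w, 'b, 'a) matching_market \<Rightarrow> ('j, 'a) driver_choice \<times> 'b shipper_choice \<Rightarrow> bool" where
  "SO_optimal M x \<longleftrightarrow> is_arg_min (social_cost M) (SO_feasible M) x"

definition shipper_equilibrium ::
  "('j, 'w, 'b, 'a) matching_market \<Rightarrow> 'b shipper_choice \<Rightarrow> ('b \<Rightarrow> real) \<Rightarrow>
   (nat \<Rightarrow> 'j \<Rightarrow> real) \<Rightarrow> bool" where
  "shipper_equilibrium M n \<mu> lam \<longleftrightarrow>
     (\<forall>j\<in>tasks M. \<forall>b\<in>shippers M j. \<forall>t\<in>shipper_alternatives M.
        (n b t > 0 \<longrightarrow> shipper_cost M b t + lam t j = \<mu> b) \<and>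
        (n b t = 0 \<longrightarrow> shipper_cost M b t + lam t j \<ge> \<mu> b))"

definition driver_equilibrium ::
  "('j, 'w, 'b, 'a) matching_market \<Rightarrow> ('j, 'a) driver_choice \<Rightarrow> ('a \<Rightarrow> real) \<Rightarrow>
   (nat \<Rightarrow> 'j \<Rightarrow> real) \<Rightarrow> bool" where
  "driver_equilibrium M m \<rho> lam \<longleftrightarrow>
     (\<forall>t\<in>windows M. \<forall>w\<in>od_pairs M. \<forall>a\<in>drivers M t w. \<forall>r\<in>driver_alternatives M.
        (m a r > 0 \<longrightarrow>
           driver_cost M a r - (\<Sum>j\<in>tasks M. task_count r j * lam t j) = \<rho> a) \<and>
        (m a r = 0 \<longrightarrow>
           driver_cost M a r - (\<Sum>j\<in>tasks M. task_count r j * lam t j) \<ge> \<rho> a))"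

definition market_clearing ::
  "('j, 'w, 'b, 'a) matching_market \<Rightarrow> ('j, 'a) driver_choice \<Rightarrow> 'b shipper_choice \<Rightarrow>
   (nat \<Rightarrow> 'j \<Rightarrow> real) \<Rightarrow> bool" where
  "market_clearing M m n lam \<longleftrightarrow>
     (\<forall>j\<in>tasks M. \<forall>t\<in>windows M.
        (lam t j > 0 \<longrightarrow> task_demand M n j t = task_supply M m j t) \<and>
        (lam t j = 0 \<longrightarrow> task_demand M n j t \<le> task_supply M m j t))"

definition equilibrium_matching_pattern ::
  "('j, 'w, 'b, 'a) matching_market \<Rightarrow> ('j, 'a) driver_choice \<Rightarrow> 'b shipper_choice \<Rightarrow>
   ('b \<Rightarrow> real) \<Rightarrow> ('a \<Rightarrow> real) \<Rightarrow> (nat \<Rightarrow> 'j \<Rightarrow> real) \<Rightarrow> bool" where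
  "equilibrium_matching_pattern M m n \<mu> \<rho> lam \<longleftrightarrow>
     shippers_choose_one M n \<and> drivers_choose_one M m \<and>
     (\<forall>t\<in>windows M. \<forall>j\<in>tasks M. lam t j \<ge> 0) \<and>
     (\<forall>j\<in>tasks M. lam 0 j = 0) \<and>
     shipper_equilibrium M n \<mu> lam \<and>
     driver_equilibrium M m \<rho> lam \<and>
     market_clearing M m n lam"

end

theory Submission
  imports Defs
begin

text \<open>
  Equilibrium prices are Lagrange multipliers for the constraints that couple the two sides
  of the market.  Add to the social cost the value, at the prices \<open>lam\<close>, of the
  excess of demand over supply.  Regrouping the terms by agent turns this Lagrangian into a sum of
  perceived costs net of payments, one summand per shipper and per driver
  (\<open>lagrangian_by_agent\<close>), so that the agents become independent of each other.
  In equilibrium every agent picks an option of least net cost, which is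
  \<open>\<mu> b\<close> or \<open>\<rho> a\<close>, so the equilibrium minimizes the Lagrangian
  over all choices, including those that violate the coupling constraints
  (\<open>shippers_net_cost_least\<close>, \<open>drivers_net_cost_least\<close>).

  The penalty term is nonpositive at every feasible point, because prices are nonnegative, and
  zero at the equilibrium, because a positive price clears its market.  Hence for feasible
  \<open>x\<close> the social cost of \<open>x\<close> is at least its Lagrangian, which is at least the
  Lagrangian of the equilibrium, which is the social cost of the equilibrium.
\<close>

definition shippers_net_cost ::
  "('j, 'w, 'b, 'a) matching_market \<Rightarrow> (nat \<Rightarrow> 'j \<Rightarrow> real) \<Rightarrow> 'b shipper_choice \<Rightarrow> real" where
  "shippers_net_cost M lam n =
     (\<Sum>j\<in>tasks M. \<Sum>b\<in>shippers M j. \<Sum>t\<in>shipper_alternatives M.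
        n b t * (shipper_cost M b t + lam t j))"

definition bundle_reward ::
  "('j, 'w, 'b, 'a) matching_market \<Rightarrow> (nat \<Rightarrow> 'j \<Rightarrow> real) \<Rightarrow> nat \<Rightarrow> 'j list \<Rightarrow> real" where
  "bundle_reward M lam t r = (\<Sum>j\<in>tasks M. task_count r j * lam t j)"

definition drivers_net_cost ::
  "('j, 'w, 'b, 'a) matching_market \<Rightarrow> (nat \<Rightarrow> 'j \<Rightarrow> real) \<Rightarrow> ('j, 'a) driver_choice \<Rightarrow> real" where
  "drivers_net_cost M lam m =
     (\<Sum>t\<in>windows M. \<Sum>w\<in>od_pairs M. \<Sum>a\<in>drivers M t w. \<Sum>r\<in>driver_alternatives M.
        m a r * (driver_cost M a r - bundle_reward M lam t r))"

definition excess_demand_value ::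
  "('j, 'w, 'b, 'a) matching_market \<Rightarrow> (nat \<Rightarrow> 'j \<Rightarrow> real) \<Rightarrow>
   ('j, 'a) driver_choice \<Rightarrow> 'b shipper_choice \<Rightarrow> real" where
  "excess_demand_value M lam m n =
     (\<Sum>j\<in>tasks M. \<Sum>t\<in>windows M. lam t j * (task_demand M n j t - task_supply M m j t))"

lemma finite_bundles:
  assumes "finite (tasks M)"
  shows "finite (bundles M)"
proof (rule finite_subset)
  show "bundles M \<subseteq> {r. set r \<subseteq> tasks M \<and> length r \<le> max_bundle M}"
    by (auto simp: bundles_def)
  show "finite {r. set r \<subseteq> tasks M \<and> length r \<le> max_bundle M}"
    using assms by (rule finite_lists_length_le)
qed

lemma sum_shipper_alternatives:
  assumes "f 0 = (0::real)"
  shows "sum f (shipper_alternatives M) = sum f (windows M)"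
  using assms by (simp add: shipper_alternatives_def windows_def)

lemma sum_driver_alternatives:
  assumes "finite (tasks M)" and "f [] = (0::real)"
  shows "sum f (driver_alternatives M) = sum f (bundles M)"
proof -
  have "[] \<notin> bundles M" by (simp add: bundles_def)
  then show ?thesis
    using assms by (simp add: driver_alternatives_def finite_bundles)
qed

lemma shipper_payments_by_market:
  assumes "\<And>j. j \<in> tasks M \<Longrightarrow> lam 0 j = 0"
  shows "(\<Sum>j\<in>tasks M. \<Sum>b\<in>shippers M j. \<Sum>t\<in>shipper_alternatives M. n b t * lam t j)
       = (\<Sum>j\<in>tasks M. \<Sum>t\<in>windows M. lam t j * task_demand M n j t)"
proof (rule sum.cong [OF refl])
  fix j assume j: "j \<in> tasks M"
  have "(\<Sum>b\<in>shippers M j. \<Sum>t\<in>shipper_alternatives M. n b t * lam t j)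
      = (\<Sum>b\<in>shippers M j. \<Sum>t\<in>windows M. n b t * lam t j)"
    using assms [OF j] by (simp add: sum_shipper_alternatives)
  also have "\<dots> = (\<Sum>t\<in>windows M. \<Sum>b\<in>shippers M j. n b t * lam t j)"
    by (rule sum.swap)
  also have "\<dots> = (\<Sum>t\<in>windows M. lam t j * task_demand M n j t)"
    by (simp add: task_demand_def sum_distrib_left mult.commute)
  finally show "(\<Sum>b\<in>shippers M j. \<Sum>t\<in>shipper_alternatives M. n b t * lam t j)
      = (\<Sum>t\<in>windows M. lam t j * task_demand M n j t)" .
qed

lemma driver_rewards_by_market:
  assumes "finite (tasks M)"
  shows "(\<Sum>t\<in>windows M. \<Sum>w\<in>od_pairs M. \<Sum>a\<in>drivers M t w. \<Sum>r\<in>driver_alternatives M.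
            m a r * bundle_reward M lam t r)
       = (\<Sum>j\<in>tasks M. \<Sum>t\<in>windows M. lam t j * task_supply M m j t)"
proof -
  have per_driver: "(\<Sum>r\<in>driver_alternatives M. m a r * bundle_reward M lam t r)
      = (\<Sum>j\<in>tasks M. \<Sum>r\<in>bundles M. lam t j * (m a r * task_count r j))" for a t
  proof -
    have "(\<Sum>r\<in>driver_alternatives M. m a r * bundle_reward M lam t r)
        = (\<Sum>r\<in>bundles M. m a r * bundle_reward M lam t r)"
      using assms by (intro sum_driver_alternatives) (simp_all add: bundle_reward_def)
    also have "\<dots> = (\<Sum>r\<in>bundles M. \<Sum>j\<in>tasks M. lam t j * (m a r * task_count r j))"
      by (simp add: bundle_reward_def sum_distrib_left mult_ac)
    also have "\<dots> = (\<Sum>j\<in>tasks M. \<Sum>r\<in>bundles M. lam t j * (m a r * task_count r j))"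
      by (rule sum.swap)
    finally show ?thesis .
  qed
  have per_window: "(\<Sum>w\<in>od_pairs M. \<Sum>a\<in>drivers M t w. \<Sum>r\<in>driver_alternatives M.
            m a r * bundle_reward M lam t r)
       = (\<Sum>j\<in>tasks M. lam t j * task_supply M m j t)" for t
  proof -
    have "(\<Sum>w\<in>od_pairs M. \<Sum>a\<in>drivers M t w. \<Sum>r\<in>driver_alternatives M.
            m a r * bundle_reward M lam t r)
        = (\<Sum>w\<in>od_pairs M. \<Sum>j\<in>tasks M. \<Sum>a\<in>drivers M t w. \<Sum>r\<in>bundles M.
            lam t j * (m a r * task_count r j))"
      unfolding per_driver by (intro sum.cong [OF refl]) (rule sum.swap)
    also have "\<dots> = (\<Sum>j\<in>tasks M. \<Sum>w\<in>od_pairs M. \<Sum>a\<in>drivers M t w. \<Sum>r\<in>bundles M.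
            lam t j * (m a r * task_count r j))"
      by (rule sum.swap)
    finally show ?thesis
      by (simp add: task_supply_def sum_distrib_left)
  qed
  show ?thesis
    unfolding per_window by (rule sum.swap)
qed

text \<open>
  The excess demand value sums price terms by market, the net costs sum them by agent.  The two
  groupings agree because neither opting out nor the empty bundle involves a payment: what
  shippers pay is the value of demand, what drivers receive is the value of supply.
\<close>

lemma lagrangian_by_agent:
  assumes "finite (tasks M)" and "\<And>j. j \<in> tasks M \<Longrightarrow> lam 0 j = 0"
  shows "social_cost M (m, n) + excess_demand_value M lam m n
       = shippers_net_cost M lam n + drivers_net_cost M lam m"
proof -
  have payments: "(\<Sum>j\<in>tasks M. \<Sum>b\<in>shippers M j. \<Sum>t\<in>shipper_alternatives M. n b t * lam t j)
      = (\<Sum>j\<in>tasks M. \<Sum>t\<in>windows M. lam t j * task_demand M n j t)"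
    using assms(2) by (rule shipper_payments_by_market)
  have "excess_demand_value M lam m n
      = (\<Sum>j\<in>tasks M. \<Sum>b\<in>shippers M j. \<Sum>t\<in>shipper_alternatives M. n b t * lam t j)
      - (\<Sum>t\<in>windows M. \<Sum>w\<in>od_pairs M. \<Sum>a\<in>drivers M t w. \<Sum>r\<in>driver_alternatives M.
            m a r * bundle_reward M lam t r)"
    unfolding payments driver_rewards_by_market [OF assms(1)]
    by (simp add: excess_demand_value_def right_diff_distrib sum_subtractf)
  then show ?thesis
    by (simp add: social_cost_def shippers_net_cost_def drivers_net_cost_def
        distrib_left right_diff_distrib sum.distrib sum_subtractf)
qed

text \<open>
  The left side equals \<open>v\<close>, as \<open>x\<close> has total weight one and sits on options
  of cost \<open>v\<close>; the right side is a weighted average of costs that are at least \<open>v\<close>.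
  This is where complementarity, hence the equilibrium condition of each agent, enters.
\<close>

lemma complementary_choice_least:
  fixes x y c :: "'i \<Rightarrow> real"
  assumes x: "sum x I = 1" and y: "sum y I = 1"
    and y_nonneg: "\<And>i. i \<in> I \<Longrightarrow> 0 \<le> y i"
    and support: "\<And>i. i \<in> I \<Longrightarrow> x i \<noteq> 0 \<Longrightarrow> c i = v"
    and bound: "\<And>i. i \<in> I \<Longrightarrow> v \<le> c i"
  shows "(\<Sum>i\<in>I. x i * c i) \<le> (\<Sum>i\<in>I. y i * c i)"
proof -
  have "(\<Sum>i\<in>I. x i * c i) = (\<Sum>i\<in>I. x i * v)"
    using support by (intro sum.cong) auto
  also have "\<dots> = (\<Sum>i\<in>I. y i * v)"
    using x y by (simp flip: sum_distrib_right)
  also have "\<dots> \<le> (\<Sum>i\<in>I. y i * c i)"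
    using y_nonneg bound by (intro sum_mono mult_left_mono)
  finally show ?thesis .
qed

lemma shippers_net_cost_least:
  assumes n: "shippers_choose_one M n" and n': "shippers_choose_one M n'"
    and eq: "shipper_equilibrium M n \<mu> lam"
  shows "shippers_net_cost M lam n \<le> shippers_net_cost M lam n'"
  unfolding shippers_net_cost_def
proof (rule sum_mono, rule sum_mono)
  fix j b assume jb: "j \<in> tasks M" "b \<in> shippers M j"
  have bin: "n b t \<in> {0, 1}" "n' b t \<in> {0, 1}" if "t \<in> shipper_alternatives M" for t
    using n n' jb that unfolding shippers_choose_one_def by blast+
  have opt: "(n b t > 0 \<longrightarrow> shipper_cost M b t + lam t j = \<mu> b) \<and>
      (n b t = 0 \<longrightarrow> shipper_cost M b t + lam t j \<ge> \<mu> b)" if "t \<in> shipper_alternatives M" for t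
    using eq jb that unfolding shipper_equilibrium_def by blast
  show "(\<Sum>t\<in>shipper_alternatives M. n b t * (shipper_cost M b t + lam t j))
      \<le> (\<Sum>t\<in>shipper_alternatives M. n' b t * (shipper_cost M b t + lam t j))"
  proof (rule complementary_choice_least
      [where v = "\<mu> b" and c = "\<lambda>t. shipper_cost M b t + lam t j"])
    show "(\<Sum>t\<in>shipper_alternatives M. n b t) = 1" "(\<Sum>t\<in>shipper_alternatives M. n' b t) = 1"
      using n n' jb unfolding shippers_choose_one_def by blast+
  next
    fix t assume t: "t \<in> shipper_alternatives M"
    show "0 \<le> n' b t"
      using bin(2) [OF t] by auto
    show "shipper_cost M b t + lam t j = \<mu> b" if "n b t \<noteq> 0"
      using bin(1) [OF t] opt [OF t] that by auto
    show "\<mu> b \<le> shipper_cost M b t + lam t j"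
      using bin(1) [OF t] opt [OF t] by auto
  qed
qed

lemma drivers_net_cost_least:
  assumes m: "drivers_choose_one M m" and m': "drivers_choose_one M m'"
    and eq: "driver_equilibrium M m \<rho> lam"
  shows "drivers_net_cost M lam m \<le> drivers_net_cost M lam m'"
  unfolding drivers_net_cost_def
proof (rule sum_mono, rule sum_mono, rule sum_mono)
  fix t w a assume twa: "t \<in> windows M" "w \<in> od_pairs M" "a \<in> drivers M t w"
  have bin: "m a r \<in> {0, 1}" "m' a r \<in> {0, 1}" if "r \<in> driver_alternatives M" for r
    using m m' twa that unfolding drivers_choose_one_def by blast+
  have opt: "(m a r > 0 \<longrightarrow> driver_cost M a r - bundle_reward M lam t r = \<rho> a) \<and>
      (m a r = 0 \<longrightarrow> driver_cost M a r - bundle_reward M lam t r \<ge> \<rho> a)"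
    if "r \<in> driver_alternatives M" for r
    using eq twa that unfolding driver_equilibrium_def bundle_reward_def by blast
  show "(\<Sum>r\<in>driver_alternatives M. m a r * (driver_cost M a r - bundle_reward M lam t r))
      \<le> (\<Sum>r\<in>driver_alternatives M. m' a r * (driver_cost M a r - bundle_reward M lam t r))"
  proof (rule complementary_choice_least
      [where v = "\<rho> a" and c = "\<lambda>r. driver_cost M a r - bundle_reward M lam t r"])
    show "(\<Sum>r\<in>driver_alternatives M. m a r) = 1" "(\<Sum>r\<in>driver_alternatives M. m' a r) = 1"
      using m m' twa unfolding drivers_choose_one_def by blast+
  next
    fix r assume r: "r \<in> driver_alternatives M"
    show "0 \<le> m' a r"
      using bin(2) [OF r] by auto
    show "driver_cost M a r - bundle_reward M lam t r = \<rho> a" if "m a r \<noteq> 0"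
      using bin(1) [OF r] opt [OF r] that by auto
    show "\<rho> a \<le> driver_cost M a r - bundle_reward M lam t r"
      using bin(1) [OF r] opt [OF r] by auto
  qed
qed

lemma excess_demand_value_nonpos:
  assumes "SO_feasible M (m, n)"
    and "\<And>t j. t \<in> windows M \<Longrightarrow> j \<in> tasks M \<Longrightarrow> 0 \<le> lam t j"
  shows "excess_demand_value M lam m n \<le> 0"
  unfolding excess_demand_value_def
  using assms by (intro sum_nonpos mult_nonneg_nonpos) (auto simp: SO_feasible_def)

lemma excess_demand_value_market_clearing:
  assumes "market_clearing M m n lam"
    and "\<And>t j. t \<in> windows M \<Longrightarrow> j \<in> tasks M \<Longrightarrow> 0 \<le> lam t j"
  shows "excess_demand_value M lam m n = 0"
  unfolding excess_demand_value_def
proof (intro sum.neutral ballI)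
  fix j t assume jt: "j \<in> tasks M" "t \<in> windows M"
  then have "lam t j = 0 \<or> task_demand M n j t = task_supply M m j t"
    using assms unfolding market_clearing_def by (metis less_eq_real_def)
  then show "lam t j * (task_demand M n j t - task_supply M m j t) = 0"
    by auto
qed

lemma SO_feasible_equilibrium:
  assumes "equilibrium_matching_pattern M m n \<mu> \<rho> lam"
  shows "SO_feasible M (m, n)"
proof -
  have "task_demand M n j t \<le> task_supply M m j t" if "j \<in> tasks M" "t \<in> windows M" for j t
  proof -
    have "lam t j > 0 \<or> lam t j = 0"
      using assms that unfolding equilibrium_matching_pattern_def by (metis less_eq_real_def)
    then show ?thesis
      using assms that unfolding equilibrium_matching_pattern_def market_clearing_def by auto
  qed
  then show ?thesis
    using assms by (simp add: SO_feasible_def equilibrium_matching_pattern_def)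
qed

lemma social_cost_equilibrium_le:
  assumes fin: "finite (tasks M)"
    and eq: "equilibrium_matching_pattern M m n \<mu> \<rho> lam"
    and feasible: "SO_feasible M (m', n')"
  shows "social_cost M (m, n) \<le> social_cost M (m', n')"
proof -
  have price_nonneg: "\<And>t j. t \<in> windows M \<Longrightarrow> j \<in> tasks M \<Longrightarrow> 0 \<le> lam t j"
    and opt_out_free: "\<And>j. j \<in> tasks M \<Longrightarrow> lam 0 j = 0"
    and clearing: "market_clearing M m n lam"
    using eq by (auto simp: equilibrium_matching_pattern_def)
  have "social_cost M (m, n) = social_cost M (m, n) + excess_demand_value M lam m n"
    using excess_demand_value_market_clearing [OF clearing price_nonneg] by simp
  also have "\<dots> = shippers_net_cost M lam n + drivers_net_cost M lam m"
    using fin opt_out_free by (rule lagrangian_by_agent)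
  also have "\<dots> \<le> shippers_net_cost M lam n' + drivers_net_cost M lam m'"
    using eq feasible unfolding equilibrium_matching_pattern_def SO_feasible_def
    by (intro add_mono shippers_net_cost_least drivers_net_cost_least) auto
  also have "\<dots> = social_cost M (m', n') + excess_demand_value M lam m' n'"
    using fin opt_out_free by (rule lagrangian_by_agent [symmetric])
  also have "\<dots> \<le> social_cost M (m', n')"
    using excess_demand_value_nonpos [OF feasible price_nonneg] by simp
  finally show ?thesis .
qed

theorem proposition2p2:
  fixes M :: "('j, 'w, 'b, 'a) matching_market"
    and m :: "('j, 'a) driver_choice" and n :: "'b shipper_choice"
    and \<mu> :: "'b \<Rightarrow> real" and \<rho> :: "'a \<Rightarrow> real" and lam :: "nat \<Rightarrow> 'j \<Rightarrow> real"
  assumes "wf_market M"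
    and "equilibrium_matching_pattern M m n \<mu> \<rho> lam"
  shows "is_arg_max (social_surplus M) (SO_feasible M) (m, n) \<and> SO_optimal M (m, n)"
proof -
  have fin: "finite (tasks M)"
    using assms(1) by (simp add: wf_market_def)
  have least: "social_cost M (m, n) \<le> social_cost M x" if "SO_feasible M x" for x
    using social_cost_equilibrium_le [OF fin assms(2)] that by (cases x) simp
  show ?thesis
    using SO_feasible_equilibrium [OF assms(2)] least
    by (simp add: SO_optimal_def is_arg_max_def is_arg_min_def social_surplus_def not_less)
qed

end
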